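(* Let $V$ and $V'$ be left vector spaces over division rings $R$ and $R'$, respectively, both of dimension at least $3$ (possibly infinite-dimensional). For every bijection $f:\mathcal{P}(V)\to\mathcal{P}(V')$ the following two conditions are equivalent: (1) $f$ is a collineation; (2) $f$ and $f^{-1}$ are both PGL-mappings.
   Context: For a left vector space $V$ over a division ring, $\mathcal{P}(V)$ is the associated projective space: its points are the $1$-dimensional subspaces of $V$, and its lines are the sets of all $1$-dimensional subspaces contained in a given $2$-dimensional subspace of $V$. $\mathrm{PGL}(V)$ is identified with the group of all transformations of $\mathcal{P}(V)$ induced by linear automorphisms of $V$, i.e. the maps $P\mapsto u(P)$ with $u\in \mathrm{GL}(V)$. A mapping $f:\mathcal{P}(V)\to\mathcal{P}(V')$ is a PGL-mapping if for every $h\in\mathrm{PGL}(V)$ there exists $h'\in\mathrm{PGL}(V')$ such that $fh=h'f$ (and analogously for mappings $\mathcal{P}(V')\to\mathcal{P}(V)$, with the roles of $V$ and $V'$ exchanged). Three distinct points of a projective space are collinear if some line contains all of them. A bijection between two projective spaces is a semicollineation if it sends every triple of (distinct) collinear points to a triple of collinear points; it is a collineation if both it and its inverse are semicollineations, equivalently, if three distinct points are collinear if and only if their images are collinear. *)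

theory Defs
  imports Main "HOL-Library.FuncSet"
begin

(* The locales module and vector_space of HOL require commutative scalars, so left vector
   spaces over division rings are set up here in the same style (names and definitions
   follow HOL.Modules).  The underlying space V is the whole type 'v. *)

locale left_vector_space =
  fixes scale :: "'r::division_ring \<Rightarrow> 'v::ab_group_add \<Rightarrow> 'v"
  assumes scale_right_distrib: "scale a (x + y) = scale a x + scale a y"
    and scale_left_distrib: "scale (a + b) x = scale a x + scale b x"
    and scale_scale: "scale a (scale b x) = scale (a * b) x"
    and scale_one: "scale 1 x = x"
begin

definition subspace :: "'v set \<Rightarrow> bool" where
  "subspace S \<longleftrightarrow> 0 \<in> S \<and> (\<forall>x\<in>S. \<forall>y\<in>S. x + y \<in> S) \<and> (\<forall>c. \<forall>x\<in>S. scale c x \<in> S)"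

definition span :: "'v set \<Rightarrow> 'v set" where
  "span B = {(\<Sum>v\<in>t. scale (c v) v) | t c. finite t \<and> t \<subseteq> B}"

definition independent :: "'v set \<Rightarrow> bool" where
  "independent B \<longleftrightarrow>
    (\<forall>t c. finite t \<and> t \<subseteq> B \<and> (\<Sum>v\<in>t. scale (c v) v) = 0 \<longrightarrow> (\<forall>v\<in>t. c v = 0))"

definition basis_of :: "'v set \<Rightarrow> 'v set \<Rightarrow> bool" where
  "basis_of S B \<longleftrightarrow> B \<subseteq> S \<and> independent B \<and> span B = S"

definition has_dim :: "'v set \<Rightarrow> nat \<Rightarrow> bool" where
  "has_dim S n \<longleftrightarrow> (\<exists>B. basis_of S B \<and> finite B \<and> card B = n)"

(* The disjunct infinite B covers infinite dimension, where card B = 0. *)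
definition dim_at_least :: "'v set \<Rightarrow> nat \<Rightarrow> bool" where
  "dim_at_least S n \<longleftrightarrow> (\<exists>B. basis_of S B \<and> (infinite B \<or> n \<le> card B))"

definition proj_points :: "'v set set" where
  "proj_points = {P. subspace P \<and> has_dim P 1}"

definition proj_lines :: "'v set set set" where
  "proj_lines = {{P \<in> proj_points. P \<subseteq> S} | S. subspace S \<and> has_dim S 2}"

definition collinear :: "'v set \<Rightarrow> 'v set \<Rightarrow> 'v set \<Rightarrow> bool" where
  "collinear P Q T \<longleftrightarrow>
    P \<noteq> Q \<and> P \<noteq> T \<and> Q \<noteq> T \<and> (\<exists>L\<in>proj_lines. P \<in> L \<and> Q \<in> L \<and> T \<in> L)"

definition GL :: "('v \<Rightarrow> 'v) set" where
  "GL = {u. bij u \<and> (\<forall>x y. u (x + y) = u x + u y) \<and> (\<forall>c x. u (scale c x) = scale c (u x))}"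

(* As transformations of the projective space, the elements of PGL are made extensional:
   they take an arbitrary fixed value on sets that are not points. *)
definition PGL :: "('v set \<Rightarrow> 'v set) set" where
  "PGL = {\<lambda>P\<in>proj_points. u ` P | u. u \<in> GL}"

end

definition pgl_mapping ::
  "('r::division_ring \<Rightarrow> 'v::ab_group_add \<Rightarrow> 'v) \<Rightarrow> ('s::division_ring \<Rightarrow> 'w::ab_group_add \<Rightarrow> 'w)
    \<Rightarrow> ('v set \<Rightarrow> 'w set) \<Rightarrow> bool" where
  "pgl_mapping scale scale' f \<longleftrightarrow>
    f \<in> left_vector_space.proj_points scale \<rightarrow> left_vector_space.proj_points scale' \<and>
    (\<forall>h\<in>left_vector_space.PGL scale. \<exists>h'\<in>left_vector_space.PGL scale'.
      \<forall>P\<in>left_vector_space.proj_points scale. f (h P) = h' (f P))"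

definition semicollineation ::
  "('r::division_ring \<Rightarrow> 'v::ab_group_add \<Rightarrow> 'v) \<Rightarrow> ('s::division_ring \<Rightarrow> 'w::ab_group_add \<Rightarrow> 'w)
    \<Rightarrow> ('v set \<Rightarrow> 'w set) \<Rightarrow> bool" where
  "semicollineation scale scale' f \<longleftrightarrow>
    bij_betw f (left_vector_space.proj_points scale) (left_vector_space.proj_points scale') \<and>
    (\<forall>P Q T. left_vector_space.collinear scale P Q T \<longrightarrow>
      left_vector_space.collinear scale' (f P) (f Q) (f T))"

definition collineation ::
  "('r::division_ring \<Rightarrow> 'v::ab_group_add \<Rightarrow> 'v) \<Rightarrow> ('s::division_ring \<Rightarrow> 'w::ab_group_add \<Rightarrow> 'w)
    \<Rightarrow> ('v set \<Rightarrow> 'w set) \<Rightarrow> bool" where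
  "collineation scale scale' f \<longleftrightarrow>
    semicollineation scale scale' f \<and>
    semicollineation scale' scale (inv_into (left_vector_space.proj_points scale) f)"

end

theory Submission
  imports Defs
begin

text \<open>
  A collineation is a PGL-mapping because of the fundamental theorem of projective geometry
  (\<open>semilinear_lift\<close>): in dimension at least three a collineation \<open>f\<close> is induced by a bijective
  semilinear map \<open>\<Phi>\<close>, and if \<open>u\<close> is linear, then so is \<open>\<Phi> u \<Phi>\<inverse>\<close>, which induces the conjugate
  under \<open>f\<close> of the transformation induced by \<open>u\<close>. The map \<open>\<Phi>\<close> is built by choosing one vector \<open>e'\<close>
  spanning the image of the point of a vector \<open>e\<close>. For \<open>x\<close> independent of \<open>e\<close> the value \<open>\<Phi> x\<close> is the
  vector spanning the image of the point of \<open>x\<close> for which \<open>e' + \<Phi> x\<close> spans the image of the point of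
  \<open>e + x\<close>. That different choices of \<open>e\<close> lead to the same map, and that it is additive, comes down to
  a configuration of lines spanned by three independent vectors (\<open>matched_triple\<close>).

  Conversely, let \<open>f\<close> and its inverse be PGL-mappings. Conjugation by \<open>f\<close> identifies the two
  projective groups, so \<open>f\<close> maps the orbits of the stabilizer of two points onto the orbits of the
  stabilizer of their images. Apart from the two points themselves, these orbits are the rest of the
  line through them and the complement of that line. The only way in which \<open>f\<close> can fail to
  preserve collinearity is therefore to interchange the two kinds of orbits
  (\<open>off_line_to_line\<close>). But then two lines through a point suffice to show that all points are mapped
  into a single line, which contradicts surjectivity
  (\<open>pgl_mappings_imp_semicollineation\<close>). Infinite dimension is no obstacle to the transitivity
  properties of the linear group used here, because transvections suffice for them
  (\<open>GL_fixing_subspace\<close>).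
\<close>

section \<open>Points and lines in terms of vectors\<close>

context left_vector_space
begin

lemma scale_zero_left [simp]: "scale 0 x = 0"
  using scale_left_distrib[of 0 0 x] by simp

lemma scale_zero_right [simp]: "scale a 0 = 0"
  using scale_right_distrib[of a 0 0] by simp

lemma scale_minus_left: "scale (- a) x = - scale a x"
  using scale_left_distrib[of a "- a" x] by (simp add: eq_neg_iff_add_eq_0 add.commute)

lemma scale_minus_right: "scale a (- x) = - scale a x"
  using scale_right_distrib[of a x "- x"] by (simp add: eq_neg_iff_add_eq_0 add.commute)

lemma scale_diff_left: "scale (a - b) x = scale a x - scale b x"
  using scale_left_distrib[of a "- b" x] by (simp add: scale_minus_left)

lemma scale_diff_right: "scale a (x - y) = scale a x - scale a y"
  using scale_right_distrib[of a x "- y"] by (simp add: scale_minus_right)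

lemmas scale_simps = scale_right_distrib scale_left_distrib scale_minus_left scale_minus_right
  scale_diff_left scale_diff_right scale_scale scale_one

lemma scale_inverse_cancel: "a \<noteq> 0 \<Longrightarrow> scale (inverse a) (scale a x) = x"
  by (simp add: scale_scale scale_one)

lemma scale_eq_0_iff: "scale a x = 0 \<longleftrightarrow> a = 0 \<or> x = 0"
  by (metis scale_inverse_cancel scale_zero_left scale_zero_right)

definition pt :: "'v \<Rightarrow> 'v set" where
  "pt x = range (\<lambda>a. scale a x)"

definition join :: "'v \<Rightarrow> 'v \<Rightarrow> 'v set" where
  "join x y = {scale a x + scale b y | a b. True}"

definition indep2 :: "'v \<Rightarrow> 'v \<Rightarrow> bool" where
  "indep2 x y \<longleftrightarrow> (\<forall>a b. scale a x + scale b y = 0 \<longrightarrow> a = 0 \<and> b = 0)"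

definition indep3 :: "'v \<Rightarrow> 'v \<Rightarrow> 'v \<Rightarrow> bool" where
  "indep3 x y z \<longleftrightarrow>
    (\<forall>a b c. scale a x + scale b y + scale c z = 0 \<longrightarrow> a = 0 \<and> b = 0 \<and> c = 0)"

lemma ptI: "scale a x \<in> pt x"
  by (simp add: pt_def)

lemma ptE: "y \<in> pt x \<Longrightarrow> (\<And>a. y = scale a x \<Longrightarrow> thesis) \<Longrightarrow> thesis"
  by (auto simp: pt_def)

lemma pt_self: "x \<in> pt x"
  using ptI[of 1 x] by (simp add: scale_one)

lemma joinI: "scale a x + scale b y \<in> join x y"
  by (auto simp: join_def)

lemma joinE: "z \<in> join x y \<Longrightarrow> (\<And>a b. z = scale a x + scale b y \<Longrightarrow> thesis) \<Longrightarrow> thesis"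
  by (auto simp: join_def)

lemma join_left: "x \<in> join x y" and join_right: "y \<in> join x y"
  using joinI[of 1 x 0 y] joinI[of 0 x 1 y] by (simp_all add: scale_one)

lemma add_in_join: "x + y \<in> join x y"
  using joinI[of 1 x 1 y] by (simp add: scale_one)

lemma subspace_pt: "subspace (pt x)"
  unfolding subspace_def
  by (auto simp: pt_def scale_left_distrib[symmetric] scale_scale image_iff intro: exI[of _ 0])

lemma subspace_join: "subspace (join x y)"
  unfolding subspace_def
proof (intro conjI ballI allI)
  show "0 \<in> join x y" using joinI[of 0 x 0 y] by simp
next
  fix u v assume "u \<in> join x y" "v \<in> join x y"
  then obtain a b c d where "u = scale a x + scale b y" "v = scale c x + scale d y"
    by (auto elim!: joinE)
  then have "u + v = scale (a + c) x + scale (b + d) y"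
    by (simp add: scale_simps algebra_simps)
  then show "u + v \<in> join x y" by (simp only: joinI)
next
  fix c u assume "u \<in> join x y"
  then show "scale c u \<in> join x y"
    by (auto elim!: joinE simp: scale_right_distrib scale_scale joinI)
qed

lemma subspace_0: "subspace S \<Longrightarrow> 0 \<in> S"
  and subspace_add: "subspace S \<Longrightarrow> x \<in> S \<Longrightarrow> y \<in> S \<Longrightarrow> x + y \<in> S"
  and subspace_scale: "subspace S \<Longrightarrow> x \<in> S \<Longrightarrow> scale c x \<in> S"
  by (simp_all add: subspace_def)

lemma subspace_minus: "subspace S \<Longrightarrow> x \<in> S \<Longrightarrow> - x \<in> S"
  using subspace_scale[of S x "- 1"] by (simp add: scale_minus_left scale_one)

lemma subspace_diff: "subspace S \<Longrightarrow> x \<in> S \<Longrightarrow> y \<in> S \<Longrightarrow> x - y \<in> S"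
  using subspace_add[of S x "- y"] subspace_minus by simp

lemma subspace_scale_iff: "subspace S \<Longrightarrow> c \<noteq> 0 \<Longrightarrow> scale c x \<in> S \<longleftrightarrow> x \<in> S"
  by (metis scale_inverse_cancel subspace_scale)

lemma pt_subset: "subspace S \<Longrightarrow> x \<in> S \<Longrightarrow> pt x \<subseteq> S"
  by (auto elim!: ptE simp: subspace_scale)

lemma join_subset: "subspace S \<Longrightarrow> x \<in> S \<Longrightarrow> y \<in> S \<Longrightarrow> join x y \<subseteq> S"
  by (auto elim!: joinE simp: subspace_scale subspace_add)

lemma pt_eq: "y \<in> pt x \<Longrightarrow> y \<noteq> 0 \<Longrightarrow> pt y = pt x"
  by (metis pt_def pt_subset subspace_pt ptE scale_eq_0_iff subspace_scale_iff pt_self subset_antisym)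

lemma indep2_iff: "indep2 x y \<longleftrightarrow> x \<noteq> 0 \<and> y \<notin> pt x"
proof
  assume *: "indep2 x y"
  have "x \<noteq> 0"
    using *[unfolded indep2_def, rule_format, of 1 0] by auto
  moreover have "y \<notin> pt x"
  proof
    assume "y \<in> pt x"
    then obtain a where "y = scale a x" by (rule ptE)
    then show False
      using *[unfolded indep2_def, rule_format, of "- a" 1] by (simp add: scale_simps)
  qed
  ultimately show "x \<noteq> 0 \<and> y \<notin> pt x" ..
next
  assume *: "x \<noteq> 0 \<and> y \<notin> pt x"
  show "indep2 x y"
    unfolding indep2_def
  proof (intro allI impI)
    fix a b assume eq: "scale a x + scale b y = 0"
    have "b = 0"
    proof (rule ccontr)
      assume "b \<noteq> 0"
      have "scale b y = scale (- a) x"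
        using eq by (simp add: scale_simps add_eq_0_iff)
      then have "scale b y \<in> pt x" by (simp add: ptI)
      with \<open>b \<noteq> 0\<close> * show False by (simp add: subspace_scale_iff subspace_pt)
    qed
    with eq * show "a = 0 \<and> b = 0" by (simp add: scale_eq_0_iff)
  qed
qed

lemma indep3_iff: "indep3 x y z \<longleftrightarrow> indep2 x y \<and> z \<notin> join x y"
proof
  assume *: "indep3 x y z"
  have "indep2 x y"
    using *[unfolded indep3_def, rule_format, of _ _ 0] by (auto simp: indep2_def)
  moreover have "z \<notin> join x y"
  proof
    assume "z \<in> join x y"
    then obtain a b where "z = scale a x + scale b y" by (rule joinE)
    then show False
      using *[unfolded indep3_def, rule_format, of "- a" "- b" 1] by (simp add: scale_simps)
  qed
  ultimately show "indep2 x y \<and> z \<notin> join x y" ..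
next
  assume *: "indep2 x y \<and> z \<notin> join x y"
  show "indep3 x y z"
    unfolding indep3_def
  proof (intro allI impI)
    fix a b c assume eq: "scale a x + scale b y + scale c z = 0"
    have "c = 0"
    proof (rule ccontr)
      assume "c \<noteq> 0"
      have "scale c z = scale (- a) x + scale (- b) y"
        using eq by (simp add: scale_simps add_eq_0_iff)
      then have "scale c z \<in> join x y" by (simp only: joinI)
      with \<open>c \<noteq> 0\<close> * show False by (simp add: subspace_scale_iff subspace_join)
    qed
    with eq * show "a = 0 \<and> b = 0 \<and> c = 0" by (simp add: indep2_def)
  qed
qed

lemma indep2_commute: "indep2 x y \<longleftrightarrow> indep2 y x"
  unfolding indep2_def by (metis add.commute)

lemma indep3_rotate: "indep3 x y z \<longleftrightarrow> indep3 y z x"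
  unfolding indep3_def by (metis add.assoc add.commute)

lemma indep3_swap: "indep3 x y z \<longleftrightarrow> indep3 y x z"
  unfolding indep3_def by (metis add.commute)

lemma indep3_pairs: "indep3 x y z \<Longrightarrow> indep2 x y \<and> indep2 y z \<and> indep2 x z"
  by (metis indep3_iff indep3_rotate indep2_commute)

lemma indep2_nonzero: "indep2 x y \<Longrightarrow> x \<noteq> 0 \<and> y \<noteq> 0"
  using indep2_commute indep2_iff by blast

lemma join_commute: "join x y = join y x"
  by (auto simp: join_def) (metis add.commute)+

lemma indep2_add: "indep2 x y \<Longrightarrow> indep2 x (x + y)"
  unfolding indep2_iff
  by (metis add_diff_cancel_left' pt_self subspace_diff subspace_pt)

lemma indep3_add: "indep3 x y z \<Longrightarrow> indep2 x (y + z)"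
  unfolding indep2_def
proof (intro allI impI)
  fix a b assume *: "indep3 x y z" "scale a x + scale b (y + z) = 0"
  then have "scale a x + scale b y + scale b z = 0" by (simp add: scale_simps algebra_simps)
  with * show "a = 0 \<and> b = 0" unfolding indep3_def by blast
qed

text \<open>Steinitz exchange in a plane. It shows that a line is determined by any two of its points, and
  also, for arbitrary \<open>e\<close> and \<open>e'\<close>, that \<open>join e e'\<close> contains no three independent vectors.\<close>

lemma join_exchange:
  assumes x: "x \<in> join e e'" and y: "y \<in> join e e'" and ind: "indep2 x y"
  shows "join x y = join e e'"
proof
  show "join x y \<subseteq> join e e'" using x y by (simp add: join_subset subspace_join)
  obtain a b where xe: "x = scale a e + scale b e'" using x by (rule joinE)
  \<comment> \<open>One of the generators can be replaced by \<open>x\<close>, the other one then by \<open>y\<close>.\<close>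
  have step: "join e1 e2 \<subseteq> join x y"
    if x1: "x = scale a e1 + scale b e2" "a \<noteq> 0" and y1: "y \<in> join e1 e2" for a b e1 e2
  proof -
    have "scale (inverse a) (x - scale b e2) = e1"
      using x1 by (simp add: scale_inverse_cancel)
    then have e1: "e1 = scale (inverse a) x - scale (inverse a * b) e2"
      by (simp add: scale_simps)
    obtain c d where "y = scale c e1 + scale d e2" using y1 by (rule joinE)
    then have "y = scale (c * inverse a) x + scale (d - c * inverse a * b) e2"
      by (subst (asm) e1) (simp add: scale_simps algebra_simps mult.assoc)
    then obtain p q where yp: "y = scale p x + scale q e2" by blast
    have "q \<noteq> 0" using yp ind by (auto simp: indep2_iff ptI)
    have "scale q e2 = y - scale p x" using yp by simp
    then have "scale q e2 \<in> join x y"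
      by (simp add: subspace_diff subspace_scale subspace_join join_left join_right)
    then have "e2 \<in> join x y" using \<open>q \<noteq> 0\<close> by (simp add: subspace_scale_iff subspace_join)
    moreover have "e1 \<in> join x y"
      using calculation
      by (subst e1) (simp add: subspace_diff subspace_scale subspace_join join_left)
    ultimately show ?thesis by (simp add: join_subset subspace_join)
  qed
  show "join e e' \<subseteq> join x y"
  proof (cases "a = 0")
    case False
    with xe y step show ?thesis by blast
  next
    case True
    have "x \<noteq> 0" using ind by (simp add: indep2_nonzero)
    with True xe have "b \<noteq> 0" by auto
    moreover have "x = scale b e' + scale a e" using xe by (simp add: add.commute)
    ultimately show ?thesis using y step join_commute by metis
  qed
qed

lemma finite_span_eq:
  assumes "finite B"
  shows "span B = {(\<Sum>v\<in>B. scale (c v) v) | c. True}"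
proof -
  have "\<exists>d. (\<Sum>v\<in>t. scale (c v) v) = (\<Sum>v\<in>B. scale (d v) v)" if "t \<subseteq> B" for t c
  proof -
    have "(\<Sum>v\<in>B. scale (if v \<in> t then c v else 0) v) = (\<Sum>v\<in>t. scale (c v) v)"
      using assms that by (intro sum.mono_neutral_cong_right) auto
    then show ?thesis by metis
  qed
  then have "(\<exists>t c. x = (\<Sum>v\<in>t. scale (c v) v) \<and> finite t \<and> t \<subseteq> B) \<longleftrightarrow>
      (\<exists>c. x = (\<Sum>v\<in>B. scale (c v) v))" for x
    using assms by (metis order_refl)
  then show ?thesis by (simp add: span_def)
qed

lemma span_singleton: "span {x} = pt x"
proof -
  have "\<exists>c. scale a x = scale (c x) x" for a by (rule exI[of _ "\<lambda>_. a"]) simp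
  then show ?thesis by (auto simp: finite_span_eq pt_def)
qed

lemma span_pair:
  assumes "x \<noteq> y" shows "span {x, y} = join x y"
proof -
  have "\<exists>c. scale a x + scale b y = scale (c x) x + scale (c y) y" for a b
    using assms by (intro exI[of _ "\<lambda>v. if v = x then a else b"]) auto
  then show ?thesis using assms by (auto simp: finite_span_eq join_def)
qed

lemma independent_singleton: "independent {x} \<longleftrightarrow> x \<noteq> 0"
proof
  assume *: "independent {x}"
  show "x \<noteq> 0"
    using *[unfolded independent_def, rule_format, of "{x}" "\<lambda>_. 1" x] by auto
next
  assume "x \<noteq> 0"
  then show "independent {x}"
    by (auto simp: independent_def subset_singleton_iff scale_eq_0_iff)
qed

lemma independent_distinct_pair:
  assumes "independent B" "x \<in> B" "y \<in> B" "x \<noteq> y"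
  shows "indep2 x y"
  unfolding indep2_def
proof (intro allI impI)
  fix a b assume "scale a x + scale b y = 0"
  then show "a = 0 \<and> b = 0"
    using assms assms(1)[unfolded independent_def, rule_format,
        of "{x, y}" "\<lambda>v. if v = x then a else b"]
    by fastforce
qed

lemma independent_distinct_triple:
  assumes "independent B" "x \<in> B" "y \<in> B" "z \<in> B" "x \<noteq> y" "x \<noteq> z" "y \<noteq> z"
  shows "indep3 x y z"
  unfolding indep3_def
proof (intro allI impI)
  fix a b c assume *: "scale a x + scale b y + scale c z = 0"
  let ?c = "\<lambda>v. if v = x then a else if v = y then b else c"
  have "(\<Sum>v\<in>{x, y, z}. scale (?c v) v) = 0"
    using assms * by (auto simp: add.assoc)
  moreover have "finite {x, y, z}" "{x, y, z} \<subseteq> B" using assms(2-4) by auto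
  ultimately have "\<forall>v\<in>{x, y, z}. ?c v = 0"
    using assms(1)[unfolded independent_def, THEN spec, THEN spec, of "{x, y, z}" ?c] by blast
  then show "a = 0 \<and> b = 0 \<and> c = 0" using assms by auto
qed

lemma independent_pair: "indep2 x y \<Longrightarrow> independent {x, y}"
proof -
  assume ind: "indep2 x y"
  then have neq: "x \<noteq> y" by (auto simp: indep2_iff pt_self)
  show "independent {x, y}"
    unfolding independent_def
  proof (intro allI impI, elim conjE)
    fix t c assume "finite t" "t \<subseteq> {x, y}" and s: "(\<Sum>v\<in>t. scale (c v) v) = 0"
    then have "(\<Sum>v\<in>{x,y}. scale (if v \<in> t then c v else 0) v) = (\<Sum>v\<in>t. scale (c v) v)"
      by (intro sum.mono_neutral_cong_right) auto
    with s neq have "scale (if x \<in> t then c x else 0) x + scale (if y \<in> t then c y else 0) y = 0"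
      by simp
    then have "(if x \<in> t then c x else 0) = 0 \<and> (if y \<in> t then c y else 0) = 0"
      using ind unfolding indep2_def by blast
    with \<open>t \<subseteq> {x, y}\<close> show "\<forall>v\<in>t. c v = 0" by (auto split: if_splits)
  qed
qed

lemma proj_points_iff: "P \<in> proj_points \<longleftrightarrow> (\<exists>x. x \<noteq> 0 \<and> P = pt x)"
proof -
  have "has_dim P 1 \<longleftrightarrow> (\<exists>x. x \<noteq> 0 \<and> P = pt x)"
  proof
    assume "has_dim P 1"
    then show "\<exists>x. x \<noteq> 0 \<and> P = pt x"
      by (auto simp: has_dim_def basis_of_def card_1_singleton_iff span_singleton
          independent_singleton)
  next
    assume "\<exists>x. x \<noteq> 0 \<and> P = pt x"
    then obtain x where "x \<noteq> 0" "P = pt x" by blast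
    then show "has_dim P 1"
      unfolding has_dim_def basis_of_def
      by (intro exI[of _ "{x}"]) (auto simp: span_singleton independent_singleton pt_self)
  qed
  then show ?thesis unfolding proj_points_def using subspace_pt by auto
qed

lemma pt_in_proj_points: "x \<noteq> 0 \<Longrightarrow> pt x \<in> proj_points"
  by (auto simp: proj_points_iff)

lemma plane_iff: "has_dim S 2 \<longleftrightarrow> (\<exists>x y. indep2 x y \<and> S = join x y)"
proof
  assume "has_dim S 2"
  then obtain B where "B \<subseteq> S" "independent B" "span B = S" "card B = 2"
    by (auto simp: has_dim_def basis_of_def)
  moreover then obtain x y where "B = {x, y}" "x \<noteq> y" by (auto simp: card_2_iff)
  ultimately show "\<exists>x y. indep2 x y \<and> S = join x y"
    by (metis independent_distinct_pair insertI1 insertI2 span_pair)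
next
  assume "\<exists>x y. indep2 x y \<and> S = join x y"
  then obtain x y where xy: "indep2 x y" "S = join x y" by blast
  then have "x \<noteq> y" by (auto simp: indep2_iff pt_self)
  with xy show "has_dim S 2"
    unfolding has_dim_def basis_of_def
    by (intro exI[of _ "{x, y}"]) (auto simp: independent_pair span_pair join_left join_right)
qed

lemma indep2_iff_pt_neq: "x \<noteq> 0 \<Longrightarrow> y \<noteq> 0 \<Longrightarrow> indep2 x y \<longleftrightarrow> pt x \<noteq> pt y"
  by (metis indep2_iff pt_eq pt_self)

lemma collinear_pt_iff:
  assumes nz: "x \<noteq> 0" "y \<noteq> 0" "z \<noteq> 0"
  shows "collinear (pt x) (pt y) (pt z) \<longleftrightarrow>
    indep2 x y \<and> indep2 x z \<and> indep2 y z \<and> z \<in> join x y"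
proof -
  have sub: "pt v \<subseteq> S \<longleftrightarrow> v \<in> S" if "subspace S" for v S
    using that pt_self pt_subset by blast
  have "(\<exists>L\<in>proj_lines. pt x \<in> L \<and> pt y \<in> L \<and> pt z \<in> L) \<longleftrightarrow>
      (\<exists>S. subspace S \<and> has_dim S 2 \<and> x \<in> S \<and> y \<in> S \<and> z \<in> S)"
    (is "?line \<longleftrightarrow> ?plane")
  proof
    assume ?line
    then show ?plane unfolding proj_lines_def using sub by auto
  next
    assume ?plane
    then obtain S where "subspace S" "has_dim S 2" "x \<in> S" "y \<in> S" "z \<in> S" by blast
    with sub nz show ?line
      unfolding proj_lines_def
      by (intro bexI[of _ "{P \<in> proj_points. P \<subseteq> S}"]) (auto simp: pt_in_proj_points)
  qed
  also have "\<dots> \<longleftrightarrow> z \<in> join x y" if "indep2 x y"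
  proof
    assume "\<exists>S. subspace S \<and> has_dim S 2 \<and> x \<in> S \<and> y \<in> S \<and> z \<in> S"
    then obtain e e' where "x \<in> join e e'" "y \<in> join e e'" "z \<in> join e e'"
      by (auto simp: plane_iff)
    then show "z \<in> join x y" using join_exchange that by blast
  next
    assume "z \<in> join x y"
    moreover have "has_dim (join x y) 2" using that by (auto simp: plane_iff)
    ultimately show "\<exists>S. subspace S \<and> has_dim S 2 \<and> x \<in> S \<and> y \<in> S \<and> z \<in> S"
      using subspace_join join_left join_right by blast
  qed
  finally show ?thesis
    using nz by (auto simp: collinear_def indep2_iff_pt_neq)
qed

lemma dim_at_least_3D:
  assumes "dim_at_least UNIV 3"
  obtains z where "z \<notin> join x y"
proof -
  obtain B where B: "independent B" "infinite B \<or> 3 \<le> card B"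
    using assms by (auto simp: dim_at_least_def basis_of_def)
  obtain C where "C \<subseteq> B" "card C = 3"
    using B(2) by (metis infinite_arbitrarily_large obtain_subset_with_card_n)
  then obtain p q r where C: "p \<in> B" "q \<in> B" "r \<in> B" "p \<noteq> q" "p \<noteq> r" "q \<noteq> r"
    by (auto simp: card_3_iff)
  then have "indep3 p q r" using B(1) by (simp add: independent_distinct_triple)
  then have "indep2 p q" "r \<notin> join p q" by (auto simp: indep3_iff)
  then have "\<not> {p, q, r} \<subseteq> join x y" using join_exchange[of p x y q] by auto
  with that show ?thesis by blast
qed

end

section \<open>Transitivity properties of the general linear group\<close>

context left_vector_space
begin

text \<open>A subspace that is maximal among those containing \<open>S\<close> but not \<open>c\<close> is a hyperplane
  complementing \<open>c\<close>; the coordinate along \<open>c\<close> is the required linear functional.\<close>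

lemma separating_functional:
  assumes S: "subspace S" and c: "c \<notin> S"
  obtains \<phi> where "\<And>x y. \<phi> (x + y) = \<phi> x + \<phi> y" "\<And>r x. \<phi> (scale r x) = r * \<phi> x"
    "\<And>s. s \<in> S \<Longrightarrow> \<phi> s = 0" "\<phi> c = 1"
proof -
  let ?A = "{H. subspace H \<and> S \<subseteq> H \<and> c \<notin> H}"
  have "\<exists>M\<in>?A. \<forall>X\<in>?A. M \<subseteq> X \<longrightarrow> X = M"
  proof (rule subset_Zorn_nonempty)
    show "?A \<noteq> {}" using S c by auto
  next
    fix \<C> assume ne: "\<C> \<noteq> {}" and ch: "subset.chain ?A \<C>"
    have mem: "subspace H" "S \<subseteq> H" "c \<notin> H" if "H \<in> \<C>" for H
      using ch that by (auto simp: subset.chain_def)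
    have "subspace (\<Union>\<C>)"
      unfolding subspace_def
    proof (intro conjI ballI allI)
      show "0 \<in> \<Union>\<C>" using ne mem subspace_0 by blast
    next
      fix x y assume "x \<in> \<Union>\<C>" "y \<in> \<Union>\<C>"
      then obtain H K where HK: "H \<in> \<C>" "x \<in> H" "K \<in> \<C>" "y \<in> K" by blast
      then have "H \<subseteq> K \<or> K \<subseteq> H" using ch by (auto simp: subset_chain_def)
      then obtain K' where K': "K' \<in> \<C>" "x \<in> K'" "y \<in> K'" using HK by blast
      then have "x + y \<in> K'" using mem(1) by (intro subspace_add)
      with K'(1) show "x + y \<in> \<Union>\<C>" by (rule UnionI)
    next
      fix r x assume "x \<in> \<Union>\<C>"
      then obtain K where K: "K \<in> \<C>" "x \<in> K" by blast
      then have "scale r x \<in> K" using mem(1) by (intro subspace_scale)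
      with K(1) show "scale r x \<in> \<Union>\<C>" by (rule UnionI)
    qed
    then show "\<Union>\<C> \<in> ?A" using ne mem by blast
  qed
  then obtain H where "H \<in> ?A" and max_A: "\<forall>X\<in>?A. H \<subseteq> X \<longrightarrow> X = H" by (rule bexE)
  then have H: "subspace H" "S \<subseteq> H" "c \<notin> H" by simp_all
  have max: "X = H" if "subspace X" "H \<subseteq> X" "c \<notin> X" for X
  proof -
    have "X \<in> ?A" using that H(2) by auto
    with max_A that(2) show ?thesis by simp
  qed
  have ex: "\<exists>r. x - scale r c \<in> H" for x
  proof (cases "x \<in> H")
    case True
    then show ?thesis by (intro exI[of _ 0]) simp
  next
    case False
    let ?X = "{h + scale r x | h r. h \<in> H}"
    have "subspace ?X"
      unfolding subspace_def
    proof (intro conjI ballI allI)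
      show "0 \<in> ?X" using subspace_0[OF H(1)] by (intro CollectI exI[of _ 0]) simp
    next
      fix y z assume "y \<in> ?X" "z \<in> ?X"
      then obtain h r k s where "y = h + scale r x" "h \<in> H" "z = k + scale s x" "k \<in> H" by blast
      then show "y + z \<in> ?X"
        using subspace_add[OF H(1)]
        by (intro CollectI exI[of _ "h + k"] exI[of _ "r + s"]) (simp add: scale_simps algebra_simps)
    next
      fix s y assume "y \<in> ?X"
      then obtain h r where "y = h + scale r x" "h \<in> H" by blast
      then show "scale s y \<in> ?X"
        using subspace_scale[OF H(1)]
        by (intro CollectI exI[of _ "scale s h"] exI[of _ "s * r"]) (simp add: scale_simps)
    qed
    moreover have "h \<in> ?X" if "h \<in> H" for h
      using that by (intro CollectI exI[of _ h] exI[of _ 0]) simp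
    then have "H \<subseteq> ?X" by blast
    moreover have "x \<in> ?X"
      using subspace_0[OF H(1)] by (intro CollectI exI[of _ 0] exI[of _ 1]) (simp add: scale_one)
    ultimately have "c \<in> ?X" using max False by blast
    then obtain h r where hr: "c = h + scale r x" "h \<in> H" by blast
    then have "r \<noteq> 0" using H(3) by auto
    have "x = scale (inverse r) (c - h)" using hr \<open>r \<noteq> 0\<close> by (simp add: scale_inverse_cancel)
    then have "x - scale (inverse r) c = - scale (inverse r) h" by (simp add: scale_simps)
    then show ?thesis using H(1) hr(2) by (metis subspace_minus subspace_scale)
  qed
  have uniq: "r = s" if "x - scale r c \<in> H" "x - scale s c \<in> H" for x r s
  proof (rule ccontr)
    assume "r \<noteq> s"
    have "scale (s - r) c = (x - scale r c) - (x - scale s c)" by (simp add: scale_simps)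
    then have "scale (s - r) c \<in> H" using that H(1) by (metis subspace_diff)
    then show False using \<open>r \<noteq> s\<close> H by (simp add: subspace_scale_iff)
  qed
  define \<phi> where "\<phi> x = (SOME r. x - scale r c \<in> H)" for x
  have \<phi>: "x - scale (\<phi> x) c \<in> H" for x unfolding \<phi>_def using ex by (rule someI_ex)
  have \<phi>_eq: "\<phi> x = r" if "x - scale r c \<in> H" for x r using uniq \<phi> that by blast
  show thesis
  proof (rule that)
    fix x y
    have "(x + y) - scale (\<phi> x + \<phi> y) c = (x - scale (\<phi> x) c) + (y - scale (\<phi> y) c)"
      by (simp add: scale_simps)
    then show "\<phi> (x + y) = \<phi> x + \<phi> y" using \<phi> H(1) by (metis \<phi>_eq subspace_add)
  next
    fix r x
    have "scale r x - scale (r * \<phi> x) c = scale r (x - scale (\<phi> x) c)"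
      by (simp add: scale_simps)
    then show "\<phi> (scale r x) = r * \<phi> x" using \<phi> H(1) by (metis \<phi>_eq subspace_scale)
  next
    fix s assume "s \<in> S"
    then show "\<phi> s = 0" using H(2) by (intro \<phi>_eq) auto
  next
    show "\<phi> c = 1" using H(1) by (intro \<phi>_eq) (simp add: scale_one subspace_0)
  qed
qed

text \<open>The required map is \<open>v \<mapsto> v + \<phi>(v) w\<close> with a functional \<open>\<phi>\<close> vanishing on \<open>S\<close> and
  \<open>w = \<phi>(c)\<inverse> (d - c)\<close>. It is invertible if and only if \<open>1 + \<phi>(w) = \<phi>(c)\<inverse> \<phi>(d)\<close> is nonzero, so
  \<open>\<phi>\<close> must vanish at neither \<open>c\<close> nor \<open>d\<close>. For \<open>S\<close> of dimension one this yields
  transitivity on the points other than a fixed one, and for \<open>S\<close> of dimension two on those off a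
  fixed line.\<close>

lemma GL_fixing_subspace:
  assumes S: "subspace S" and c: "c \<notin> S" and d: "d \<notin> S"
  obtains u where "u \<in> GL" "\<And>s. s \<in> S \<Longrightarrow> u s = s" "u c = d"
proof -
  obtain \<phi>1 where f1: "\<And>x y. \<phi>1 (x + y) = \<phi>1 x + \<phi>1 y" "\<And>r x. \<phi>1 (scale r x) = r * \<phi>1 x"
    "\<And>s. s \<in> S \<Longrightarrow> \<phi>1 s = 0" "\<phi>1 c = 1" using separating_functional[OF S c] by blast
  obtain \<phi>2 where f2: "\<And>x y. \<phi>2 (x + y) = \<phi>2 x + \<phi>2 y" "\<And>r x. \<phi>2 (scale r x) = r * \<phi>2 x"
    "\<And>s. s \<in> S \<Longrightarrow> \<phi>2 s = 0" "\<phi>2 d = 1" using separating_functional[OF S d] by blast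
  obtain \<phi> where f: "\<And>x y. \<phi> (x + y) = \<phi> x + \<phi> y" "\<And>r x. \<phi> (scale r x) = r * \<phi> x"
    "\<And>s. s \<in> S \<Longrightarrow> \<phi> s = 0" "\<phi> c \<noteq> 0" "\<phi> d \<noteq> 0"
  proof -
    consider "\<phi>1 d \<noteq> 0" | "\<phi>2 c \<noteq> 0" | "\<phi>1 d = 0" "\<phi>2 c = 0" by blast
    then show ?thesis
    proof cases
      case 1 then show ?thesis using that[of \<phi>1] f1 by simp
    next
      case 2 then show ?thesis using that[of \<phi>2] f2 by simp
    next
      case 3
      then show ?thesis using that[of "\<lambda>x. \<phi>1 x + \<phi>2 x"] f1 f2 by (simp add: algebra_simps)
    qed
  qed
  have f_diff: "\<phi> (x - y) = \<phi> x - \<phi> y" for x y using f(1)[of "x - y" y] by simp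
  define w where "w = scale (inverse (\<phi> c)) (d - c)"
  define k where "k = 1 + \<phi> w"
  define u where "u x = x + scale (\<phi> x) w" for x
  define u' where "u' x = x - scale (\<phi> x * inverse k) w" for x
  have "k = inverse (\<phi> c) * \<phi> d"
    using f(4) by (simp add: k_def w_def f(2) f_diff right_diff_distrib)
  then have "k \<noteq> 0" using f(4,5) by simp
  have fu: "\<phi> (u x) = \<phi> x * k" for x by (simp add: u_def f(1,2) k_def distrib_left)
  have "u' (u x) = x" for x
    by (simp add: u'_def fu mult.assoc \<open>k \<noteq> 0\<close>) (simp add: u_def)
  moreover have "u (u' x) = x" for x
  proof -
    have "\<phi> (u' x) = \<phi> x - \<phi> x * inverse k * \<phi> w" by (simp add: u'_def f_diff f(2))
    also have "\<phi> w = k - 1" by (simp add: k_def)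
    also have "\<phi> x - \<phi> x * inverse k * (k - 1) = \<phi> x * inverse k"
      using \<open>k \<noteq> 0\<close> by (simp add: right_diff_distrib mult.assoc)
    finally show ?thesis by (simp add: u_def) (simp add: u'_def)
  qed
  ultimately have "bij u" by (intro o_bij[of u']) (auto simp: fun_eq_iff)
  moreover have "u (x + y) = u x + u y" for x y by (simp add: u_def f(1) scale_simps algebra_simps)
  moreover have "u (scale r x) = scale r (u x)" for r x by (simp add: u_def f(2) scale_simps)
  ultimately have "u \<in> GL" by (simp add: GL_def)
  moreover have "u s = s" if "s \<in> S" for s using that by (simp add: u_def f(3))
  moreover have "u c = d" using f(4) by (simp add: u_def w_def scale_scale scale_one)
  ultimately show thesis by (rule that)
qed

lemma GL_0: "u \<in> GL \<Longrightarrow> u 0 = 0"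
  by (simp add: GL_def) (metis add_cancel_right_left)

lemma GL_nonzero: "u \<in> GL \<Longrightarrow> x \<noteq> 0 \<Longrightarrow> u x \<noteq> 0"
  by (metis (mono_tags, lifting) GL_0 GL_def bij_def injD mem_Collect_eq)

lemma GL_image_pt: "u \<in> GL \<Longrightarrow> u ` pt x = pt (u x)"
  by (auto simp: GL_def pt_def image_iff)

lemma GL_image_point: "u \<in> GL \<Longrightarrow> P \<in> proj_points \<Longrightarrow> u ` P \<in> proj_points"
  using GL_nonzero by (auto simp: proj_points_iff GL_image_pt) blast

lemma GL_join_iff:
  assumes "u \<in> GL"
  shows "u z \<in> join (u x) (u y) \<longleftrightarrow> z \<in> join x y"
proof -
  have "scale a (u x) + scale b (u y) = u (scale a x + scale b y)" for a b
    using assms by (simp add: GL_def)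
  moreover have "u v = u v' \<longleftrightarrow> v = v'" for v v'
    using assms by (auto simp: GL_def bij_def dest: injD)
  ultimately show ?thesis by (auto simp: join_def)
qed

end

section \<open>Mappings that conjugate the projective groups into each other\<close>

locale two_vector_spaces =
  V: left_vector_space scale + W: left_vector_space scale'
  for scale :: "'r::division_ring \<Rightarrow> 'v::ab_group_add \<Rightarrow> 'v"
    and scale' :: "'s::division_ring \<Rightarrow> 'w::ab_group_add \<Rightarrow> 'w"
begin

lemma pgl_mapping_iff:
  "pgl_mapping scale scale' f \<longleftrightarrow>
    f \<in> V.proj_points \<rightarrow> W.proj_points \<and>
    (\<forall>u\<in>V.GL. \<exists>u'\<in>W.GL. \<forall>P\<in>V.proj_points. f (u ` P) = u' ` f P)"
proof (cases "f \<in> V.proj_points \<rightarrow> W.proj_points")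
  case True
  then have *: "f P \<in> W.proj_points" if "P \<in> V.proj_points" for P using that by auto
  have "(\<forall>P\<in>V.proj_points. f ((\<lambda>P\<in>V.proj_points. u ` P) P) = (\<lambda>P\<in>W.proj_points. u' ` P) (f P))
      \<longleftrightarrow> (\<forall>P\<in>V.proj_points. f (u ` P) = u' ` f P)" for u u'
    using * by simp
  moreover have "V.PGL = (\<lambda>u. \<lambda>P\<in>V.proj_points. u ` P) ` V.GL"
    and "W.PGL = (\<lambda>u. \<lambda>P\<in>W.proj_points. u ` P) ` W.GL"
    by (auto simp: V.PGL_def W.PGL_def)
  ultimately show ?thesis using True unfolding pgl_mapping_def by simp
qed (simp add: pgl_mapping_def)

text \<open>The points off the line through \<open>f (pt p)\<close> and \<open>f (pt q)\<close> form one orbit of the stabilizer of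
  these two points, and the inverse of \<open>f\<close> carries it into an orbit of the stabilizer of \<open>pt p\<close> and
  \<open>pt q\<close>. If it contains the image of a point \<open>pt t\<close> on the line through \<open>pt p\<close> and \<open>pt q\<close>, then it
  cannot contain the image of a point off that line.\<close>

lemma off_line_to_line:
  assumes bij: "bij_betw f V.proj_points W.proj_points"
    and conj: "\<And>u'. u' \<in> W.GL \<Longrightarrow> \<exists>u\<in>V.GL. \<forall>P\<in>V.proj_points. f (u ` P) = u' ` f P"
    and nz: "p \<noteq> 0" "q \<noteq> 0" "t \<noteq> 0" and t: "t \<in> V.join p q"
    and img: "f (V.pt p) = W.pt p'" "f (V.pt q) = W.pt q'" "f (V.pt t) = W.pt t'"
    and t': "t' \<notin> W.join p' q'"
    and x: "x \<notin> V.join p q"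
  shows "f (V.pt x) \<subseteq> W.join p' q'"
proof -
  have "x \<noteq> 0" using x V.subspace_0[OF V.subspace_join] by blast
  then have "f (V.pt x) \<in> W.proj_points" using bij by (auto simp: V.pt_in_proj_points bij_betw_apply)
  then obtain x' where x': "x' \<noteq> 0" "f (V.pt x) = W.pt x'" by (auto simp: W.proj_points_iff)
  have "x' \<in> W.join p' q'"
  proof (rule ccontr)
    assume "x' \<notin> W.join p' q'"
    with t' obtain u' where u': "u' \<in> W.GL" "\<And>s. s \<in> W.join p' q' \<Longrightarrow> u' s = s" "u' t' = x'"
      using W.GL_fixing_subspace[OF W.subspace_join] by metis
    obtain u where u: "u \<in> V.GL" "\<And>P. P \<in> V.proj_points \<Longrightarrow> f (u ` P) = u' ` f P"
      using conj[OF u'(1)] by blast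
    have move: "V.pt (u a) = V.pt b"
      if "a \<noteq> 0" "b \<noteq> 0" "f (V.pt a) = W.pt a'" "f (V.pt b) = W.pt (u' a')" for a b a'
    proof -
      have "f (V.pt (u a)) = u' ` f (V.pt a)"
        using u that(1) by (simp add: V.pt_in_proj_points flip: V.GL_image_pt)
      also have "\<dots> = f (V.pt b)" using that u' by (simp add: W.GL_image_pt)
      finally show ?thesis
        using bij that u(1)
        by (auto simp: bij_betw_def inj_on_def V.pt_in_proj_points V.GL_nonzero)
    qed
    have "V.pt (u p) = V.pt p" "V.pt (u q) = V.pt q"
      using move[of p p p'] move[of q q q'] nz img u'(2) W.join_left W.join_right by auto
    then have "V.join (u p) (u q) \<subseteq> V.join p q"
      by (metis V.join_subset V.subspace_join V.join_left V.join_right V.pt_subset V.pt_self subsetD)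
    moreover have "u t \<in> V.join (u p) (u q)" using t u(1) by (simp add: V.GL_join_iff)
    moreover have "V.pt (u t) = V.pt x"
      using move[of t x t'] nz \<open>x \<noteq> 0\<close> img x' u'(3) by simp
    ultimately have "x \<in> V.join p q"
      by (metis V.subspace_join V.pt_subset V.pt_self subsetD)
    with x show False ..
  qed
  then show ?thesis using x' by (simp add: W.pt_subset W.subspace_join)
qed

text \<open>If a collinear triple had a noncollinear image, then, as the linear group acts transitively on
  pairs of points, the preceding lemma would apply to every pair of points. Two intersecting lines
  through \<open>P\<close> already suffice to conclude that \<open>f\<close> maps everything into a single line, contrary to
  surjectivity.\<close>

lemma pgl_mappings_imp_semicollineation:
  assumes dimV: "V.dim_at_least UNIV 3" and dimW: "W.dim_at_least UNIV 3"
    and bij: "bij_betw f V.proj_points W.proj_points"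
    and conj: "\<And>u. u \<in> V.GL \<Longrightarrow> \<exists>u'\<in>W.GL. \<forall>P\<in>V.proj_points. f (u ` P) = u' ` f P"
    and conj': "\<And>u'. u' \<in> W.GL \<Longrightarrow> \<exists>u\<in>V.GL. \<forall>P\<in>V.proj_points. f (u ` P) = u' ` f P"
  shows "semicollineation scale scale' f"
  unfolding semicollineation_def
proof (intro conjI allI impI)
  fix P Q T assume col: "V.collinear P Q T"
  then have PQT: "P \<in> V.proj_points" "Q \<in> V.proj_points" "T \<in> V.proj_points"
    by (auto simp: V.collinear_def V.proj_lines_def)
  obtain p q t where v: "p \<noteq> 0" "P = V.pt p" "q \<noteq> 0" "Q = V.pt q" "t \<noteq> 0" "T = V.pt t"
    using PQT by (auto simp: V.proj_points_iff)
  have "f P \<in> W.proj_points" "f Q \<in> W.proj_points" "f T \<in> W.proj_points"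
    using PQT bij by (auto simp: bij_betw_apply)
  then obtain p' q' t' where v': "p' \<noteq> 0" "f P = W.pt p'" "q' \<noteq> 0" "f Q = W.pt q'"
    "t' \<noteq> 0" "f T = W.pt t'" by (auto simp: W.proj_points_iff)
  have vcol: "V.indep2 p q" "V.indep2 p t" "V.indep2 q t" "t \<in> V.join p q"
    using col v by (auto simp: V.collinear_pt_iff)
  have "f P \<noteq> f Q" "f P \<noteq> f T" "f Q \<noteq> f T"
    using col PQT bij by (auto simp: V.collinear_def bij_betw_def inj_on_def)
  then have ind': "W.indep2 p' q'" "W.indep2 p' t'" "W.indep2 q' t'"
    using v' by (auto simp: W.indep2_iff_pt_neq)
  show "W.collinear (f P) (f Q) (f T)"
  proof (rule ccontr)
    assume "\<not> W.collinear (f P) (f Q) (f T)"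
    then have t': "t' \<notin> W.join p' q'" using v' ind' by (simp add: W.collinear_pt_iff)
    have off: "f (V.pt x) \<subseteq> W.join p' q'" if "x \<notin> V.join p q" for x
      using off_line_to_line[OF bij conj', of p q t p' q' t' x] v v' vcol t' that by auto
    \<comment> \<open>A linear map that fixes \<open>p\<close> and sends \<open>q\<close> to \<open>x\<close> transports this to the line of \<open>p\<close> and \<open>x\<close>, whose
      image points also lie on the line of \<open>p'\<close> and \<open>q'\<close>.\<close>
    obtain x where x: "x \<notin> V.join p q" using V.dim_at_least_3D[OF dimV] by blast
    then have "x \<noteq> 0" using V.subspace_0[OF V.subspace_join] by blast
    have "q \<notin> V.pt p" using vcol(1) by (simp add: V.indep2_iff)
    moreover have "x \<notin> V.pt p" using x V.pt_subset[OF V.subspace_join V.join_left] by blast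
    ultimately obtain u where u: "u \<in> V.GL" "\<And>s. s \<in> V.pt p \<Longrightarrow> u s = s" "u q = x"
      using V.GL_fixing_subspace[OF V.subspace_pt] by metis
    obtain u' where u': "u' \<in> W.GL" "\<And>P. P \<in> V.proj_points \<Longrightarrow> f (u ` P) = u' ` f P"
      using conj[OF u(1)] by blast
    have img: "f (V.pt (u a)) = W.pt (u' a')" if "a \<noteq> 0" "f (V.pt a) = W.pt a'" for a a'
      using that u'(2)[of "V.pt a"] u(1) u'(1)
      by (simp add: V.pt_in_proj_points V.GL_image_pt W.GL_image_pt)
    have up: "u p = p" using u(2) V.pt_self by blast
    have "u' p' \<in> W.pt p'" using img[of p p'] v v' up W.pt_self by auto
    moreover have "u' q' \<in> W.join p' q'"
      using img[of q q'] v v' u(3) off[OF x] W.pt_self by auto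
    ultimately have sub: "W.join (u' p') (u' q') \<subseteq> W.join p' q'"
      using W.join_left W.pt_subset W.subspace_join by (intro W.join_subset) blast+
    have off2: "f (V.pt y) \<subseteq> W.join p' q'" if "y \<notin> V.join p x" for y
    proof -
      have "f (V.pt y) \<subseteq> W.join (u' p') (u' q')"
      proof (rule off_line_to_line[OF bij conj', of p x "u t" _ _ "u' t'"])
        show "u t \<in> V.join p x" using V.GL_join_iff[OF u(1), of t p q] vcol up u(3) by simp
        show "u' t' \<notin> W.join (u' p') (u' q')" using t' u'(1) by (simp add: W.GL_join_iff)
        show "f (V.pt p) = W.pt (u' p')" using img[of p p'] v v' up by simp
        show "f (V.pt x) = W.pt (u' q')" using img[of q q'] v v' u(3) by simp
        show "f (V.pt (u t)) = W.pt (u' t')" using img[of t t'] v v' by simp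
      qed (use v u(1) \<open>x \<noteq> 0\<close> that in \<open>auto simp: V.GL_nonzero\<close>)
      with sub show ?thesis by blast
    qed
    have all: "f (V.pt y) \<subseteq> W.join p' q'" if "y \<noteq> 0" for y
    proof (cases "y \<in> V.pt p")
      case True
      then have "f (V.pt y) = W.pt p'" using that v v' V.pt_eq by simp
      then show ?thesis by (simp add: W.pt_subset W.subspace_join W.join_left)
    next
      case False
      then have ind: "V.indep2 p y" using v by (simp add: V.indep2_iff)
      have "y \<notin> V.join p q \<or> y \<notin> V.join p x"
        using V.join_exchange[OF V.join_left _ ind] x V.join_right by metis
      then show ?thesis using off off2 by blast
    qed
    obtain z where z: "z \<notin> W.join p' q'" using W.dim_at_least_3D[OF dimW] by blast
    then have "z \<noteq> 0" using W.subspace_0[OF W.subspace_join] by blast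
    then have "W.pt z \<in> f ` V.proj_points"
      using bij by (simp add: bij_betw_def W.pt_in_proj_points)
    then obtain y where "y \<noteq> 0" "W.pt z = f (V.pt y)" by (auto simp: V.proj_points_iff)
    then show False using all z W.pt_self by blast
  qed
qed (rule bij)

end

section \<open>Collineations are induced by semilinear maps\<close>

locale collinear_bijection = two_vector_spaces scale scale'
  for scale :: "'r::division_ring \<Rightarrow> 'v::ab_group_add \<Rightarrow> 'v"
    and scale' :: "'s::division_ring \<Rightarrow> 'w::ab_group_add \<Rightarrow> 'w" +
  fixes f :: "'v set \<Rightarrow> 'w set"
  assumes bij: "bij_betw f V.proj_points W.proj_points"
    and collinear_iff: "\<And>P Q T. P \<in> V.proj_points \<Longrightarrow> Q \<in> V.proj_points \<Longrightarrow> T \<in> V.proj_points \<Longrightarrow>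
      W.collinear (f P) (f Q) (f T) \<longleftrightarrow> V.collinear P Q T"
    and dim: "V.dim_at_least UNIV 3"
begin

definition rep :: "'v \<Rightarrow> 'w \<Rightarrow> bool" where
  "rep x x' \<longleftrightarrow> x \<noteq> 0 \<and> x' \<noteq> 0 \<and> f (V.pt x) = W.pt x'"

lemma rep_ex: "x \<noteq> 0 \<Longrightarrow> \<exists>x'. rep x x'"
  using bij_betw_apply[OF bij, of "V.pt x"] V.pt_in_proj_points
  by (auto simp: rep_def W.proj_points_iff)

lemma rep_surj: "x' \<noteq> 0 \<Longrightarrow> \<exists>x. rep x x'"
proof -
  assume "x' \<noteq> 0"
  then have "W.pt x' \<in> f ` V.proj_points"
    using bij by (simp add: bij_betw_def W.pt_in_proj_points)
  with \<open>x' \<noteq> 0\<close> show ?thesis by (auto simp: rep_def V.proj_points_iff)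
qed

lemma rep_unique: "rep x x' \<Longrightarrow> rep x x'' \<Longrightarrow> x'' \<in> W.pt x'"
  by (metis rep_def W.pt_self)

lemma rep_cong: "rep x x' \<Longrightarrow> y \<in> V.pt x \<Longrightarrow> y \<noteq> 0 \<Longrightarrow> y' \<in> W.pt x' \<Longrightarrow> y' \<noteq> 0 \<Longrightarrow> rep y y'"
  by (simp add: rep_def V.pt_eq W.pt_eq)

lemma rep_indep2: "rep x x' \<Longrightarrow> rep y y' \<Longrightarrow> W.indep2 x' y' \<longleftrightarrow> V.indep2 x y"
  using inj_on_eq_iff[OF bij_betw_imp_inj_on[OF bij], of "V.pt x" "V.pt y"]
  by (simp add: rep_def V.indep2_iff_pt_neq W.indep2_iff_pt_neq V.pt_in_proj_points)

lemma rep_join: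
  assumes x: "rep x x'" and y: "rep y y'" and z: "rep z z'" and ind: "V.indep2 x y"
  shows "z' \<in> W.join x' y' \<longleftrightarrow> z \<in> V.join x y"
proof (cases "V.indep2 x z \<and> V.indep2 y z")
  case True
  have "W.indep2 x' y'" "W.indep2 x' z'" "W.indep2 y' z'"
    using rep_indep2 assms True by blast+
  with collinear_iff[of "V.pt x" "V.pt y" "V.pt z"] x y z ind True show ?thesis
    by (simp add: rep_def V.pt_in_proj_points V.collinear_pt_iff W.collinear_pt_iff)
next
  case False
  then have "z \<in> V.pt x \<or> z \<in> V.pt y" using x y by (auto simp: rep_def V.indep2_iff)
  moreover have "z' \<in> W.pt x' \<or> z' \<in> W.pt y'"
    using False rep_indep2[OF x z] rep_indep2[OF y z] x y by (auto simp: rep_def W.indep2_iff)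
  ultimately show ?thesis
    using V.pt_subset[OF V.subspace_join] W.pt_subset[OF W.subspace_join]
      V.join_left V.join_right W.join_left W.join_right by blast
qed

lemma rep_indep3:
  "rep x x' \<Longrightarrow> rep y y' \<Longrightarrow> rep z z' \<Longrightarrow> V.indep3 x y z \<Longrightarrow> W.indep3 x' y' z'"
  by (auto simp: V.indep3_iff W.indep3_iff rep_indep2 rep_join)

text \<open>An additive map inducing \<open>f\<close> that sends \<open>x\<close> to \<open>x'\<close> and \<open>y\<close> to \<open>y'\<close> must send \<open>x + y\<close> to \<open>x' + y'\<close>,
  so the latter must span the image of \<open>pt (x + y)\<close>.\<close>

definition matched :: "'v \<Rightarrow> 'w \<Rightarrow> 'v \<Rightarrow> 'w \<Rightarrow> bool" where
  "matched x x' y y' \<longleftrightarrow> V.indep2 x y \<and> rep x x' \<and> rep y y' \<and> rep (x + y) (x' + y')"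

lemma matched_sym: "matched x x' y y' \<Longrightarrow> matched y y' x x'"
  by (auto simp: matched_def add.commute V.indep2_commute)

lemma matched_ex:
  assumes ind: "V.indep2 x y" and x: "rep x x'"
  shows "\<exists>y'. matched x x' y y'"
proof -
  have nz: "x \<noteq> 0" "y \<noteq> 0" using ind V.indep2_nonzero by auto
  have ind1: "V.indep2 x (x + y)" using ind by (rule V.indep2_add)
  have ind2: "V.indep2 y (x + y)"
    using V.indep2_add[of y x] ind by (simp add: V.indep2_commute add.commute)
  have "x + y \<noteq> 0" using ind1 V.indep2_nonzero by blast
  then obtain w' z' where w: "rep y w'" and z: "rep (x + y) z'" using nz rep_ex by blast
  have "z' \<in> W.join x' w'" using rep_join[OF x w z ind] V.add_in_join by simp
  then obtain a b where ab: "z' = scale' a x' + scale' b w'" by (rule W.joinE)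
  have "z' \<notin> W.pt w'" "z' \<notin> W.pt x'"
    using rep_indep2[OF w z] rep_indep2[OF x z] ind1 ind2 by (auto simp: W.indep2_iff)
  with ab have "a \<noteq> 0" "b \<noteq> 0" using W.ptI by auto
  let ?y' = "scale' (inverse a * b) w'"
  have "?y' \<noteq> 0" using w \<open>a \<noteq> 0\<close> \<open>b \<noteq> 0\<close> by (simp add: rep_def W.scale_eq_0_iff)
  then have "rep y ?y'" by (rule rep_cong[OF w V.pt_self nz(2) W.ptI])
  moreover have eq: "x' + ?y' = scale' (inverse a) z'"
    using ab \<open>a \<noteq> 0\<close> by (simp add: W.scale_simps)
  moreover have "scale' (inverse a) z' \<noteq> 0"
    using z \<open>a \<noteq> 0\<close> by (simp add: rep_def W.scale_eq_0_iff)
  then have "rep (x + y) (x' + ?y')"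
    unfolding eq by (rule rep_cong[OF z V.pt_self \<open>x + y \<noteq> 0\<close> W.ptI])
  ultimately show ?thesis using ind x by (auto simp: matched_def)
qed

lemma matched_unique:
  assumes m: "matched x x' y y'" and m': "matched x x' y y''"
  shows "y' = y''"
proof -
  obtain b where b: "y'' = scale' b y'"
    using m m' rep_unique W.ptE unfolding matched_def by metis
  obtain e where e: "x' + y'' = scale' e (x' + y')"
    using m m' rep_unique W.ptE unfolding matched_def by metis
  have "scale' (1 - e) x' + scale' (b - e) y' = 0"
    using b e by (simp add: W.scale_simps algebra_simps)
  moreover have "W.indep2 x' y'" using m rep_indep2 by (auto simp: matched_def)
  ultimately have "1 - e = 0" "b - e = 0" unfolding W.indep2_def by blast+
  then have "b = 1" by simp
  with b show ?thesis by (simp add: W.scale_one)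
qed

text \<open>The point \<open>pt (x + y + z)\<close> is the intersection of the line through \<open>pt (x + y)\<close> and \<open>pt z\<close> with
  the line through \<open>pt (x + z)\<close> and \<open>pt y\<close>. The image point is thereby determined, and so then is that
  of \<open>pt (y + z)\<close>, which lies on the line through \<open>pt y\<close> and \<open>pt z\<close> and on the one through \<open>pt x\<close> and
  \<open>pt (x + y + z)\<close>.\<close>

lemma matched_triple:
  assumes ind: "V.indep3 x y z" and xy: "matched x x' y y'" and xz: "matched x x' z z'"
  shows "matched y y' z z'" and "matched x x' (y + z) (y' + z')"
proof -
  have r: "rep x x'" "rep y y'" "rep z z'" "rep (x + y) (x' + y')" "rep (x + z) (x' + z')"
    using xy xz by (auto simp: matched_def)
  have ind': "W.indep3 x' y' z'" using rep_indep3 r ind by blast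
  have yz: "V.indep2 y z" and x_yz: "V.indep2 x (y + z)"
    using ind by (auto simp: V.indep3_pairs V.indep3_add)
  have i1: "V.indep2 z (x + y)" and i2: "V.indep2 y (x + z)"
    using ind V.indep3_add V.indep3_rotate V.indep3_swap by blast+
  have sum_ind: "V.indep2 x (x + y + z)"
    using V.indep2_add[OF x_yz] by (simp add: add.assoc)
  then have "x + y + z \<noteq> 0" "y + z \<noteq> 0" using x_yz V.indep2_nonzero by auto
  then obtain s' t' where s: "rep (x + y + z) s'" and t: "rep (y + z) t'" using rep_ex by blast
  have "x + y + z \<in> V.join z (x + y)" "x + y + z \<in> V.join y (x + z)"
    using V.add_in_join[of z "x + y"] V.add_in_join[of y "x + z"] by (simp_all add: ac_simps)
  then have "s' \<in> W.join z' (x' + y')" "s' \<in> W.join y' (x' + z')"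
    using rep_join[OF r(3,4) s i1] rep_join[OF r(2,5) s i2] by auto
  then obtain a b c d where "s' = scale' a z' + scale' b (x' + y')"
    and s': "s' = scale' c y' + scale' d (x' + z')"
    by (elim W.joinE)
  then have "scale' (b - d) x' + scale' (b - c) y' + scale' (a - d) z' = 0"
    by (simp add: W.scale_simps algebra_simps)
  then have "b - d = 0 \<and> b - c = 0 \<and> a - d = 0" using ind' unfolding W.indep3_def by blast
  then have "c = d" by auto
  with s' have s'_eq: "s' = scale' d (x' + y' + z')" by (simp add: W.scale_simps algebra_simps)
  then have "d \<noteq> 0" using s by (auto simp: rep_def)
  have "x' + y' + z' = scale' (inverse d) s'"
    using s'_eq \<open>d \<noteq> 0\<close> by (simp add: W.scale_inverse_cancel)
  then have "x' + y' + z' \<in> W.pt s'" "x' + y' + z' \<noteq> 0"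
    using W.ptI s \<open>d \<noteq> 0\<close> by (auto simp: W.scale_eq_0_iff rep_def)
  then have sum: "rep (x + y + z) (x' + y' + z')"
    using rep_cong[OF s V.pt_self] \<open>x + y + z \<noteq> 0\<close> by blast
  have "y + z = (x + y + z) - x" by simp
  then have "y + z \<in> V.join x (x + y + z)"
    by (metis V.join_left V.join_right V.subspace_diff V.subspace_join)
  then have "t' \<in> W.join x' (x' + y' + z')" "t' \<in> W.join y' z'"
    using rep_join[OF r(1) sum t sum_ind] rep_join[OF r(2,3) t yz] V.add_in_join by auto
  then obtain a b c d where "t' = scale' a x' + scale' b (x' + y' + z')"
    and t': "t' = scale' c y' + scale' d z'"
    by (elim W.joinE)
  then have "scale' (a + b) x' + scale' (b - c) y' + scale' (b - d) z' = 0"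
    by (simp add: W.scale_simps algebra_simps)
  then have "a + b = 0 \<and> b - c = 0 \<and> b - d = 0" using ind' unfolding W.indep3_def by blast
  then have "c = d" by auto
  with t' have t'_eq: "t' = scale' d (y' + z')" by (simp add: W.scale_simps)
  then have "d \<noteq> 0" using t by (auto simp: rep_def)
  have "y' + z' = scale' (inverse d) t'"
    using t'_eq \<open>d \<noteq> 0\<close> by (simp add: W.scale_inverse_cancel)
  then have "y' + z' \<in> W.pt t'" "y' + z' \<noteq> 0"
    using W.ptI t \<open>d \<noteq> 0\<close> by (auto simp: W.scale_eq_0_iff rep_def)
  then have sum2: "rep (y + z) (y' + z')"
    using rep_cong[OF t V.pt_self] \<open>y + z \<noteq> 0\<close> by blast
  show "matched y y' z z'" using yz r sum2 by (simp add: matched_def)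
  show "matched x x' (y + z) (y' + z')"
    using x_yz r sum sum2 by (simp add: matched_def add.assoc)
qed

lemma indep3_ex:
  assumes "V.indep2 x y" obtains z where "V.indep3 x y z"
  using assms V.dim_at_least_3D[OF dim] by (metis V.indep3_iff)

lemma indep3_exchange:
  assumes "V.indep3 x y z" "a \<in> V.join x y" "b \<in> V.join x y" "V.indep2 a b"
  shows "V.indep3 a b z"
  using assms(1,4) V.join_exchange[OF assms(2-4)] by (simp add: V.indep3_iff)

text \<open>When \<open>e\<close>, \<open>x\<close>, \<open>y\<close> are dependent, one passes through a vector outside their plane.\<close>

lemma matched_trans:
  assumes x: "matched e e' x x'" and y: "matched e e' y y'" and ind: "V.indep2 x y"
  shows "matched x x' y y'"
proof (cases "V.indep3 e x y")
  case True
  then show ?thesis using x y by (rule matched_triple(1))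
next
  case False
  have ex: "V.indep2 e x" and ey: "V.indep2 e y" using x y by (auto simp: matched_def)
  have y_in: "y \<in> V.join e x" using False ex by (simp add: V.indep3_iff)
  obtain b where exb: "V.indep3 e x b" using ex by (rule indep3_ex)
  then have "V.indep2 e b" using V.indep3_pairs by blast
  moreover have "rep e e'" using x by (simp add: matched_def)
  ultimately obtain b' where b: "matched e e' b b'" using matched_ex by blast
  have eyb: "V.indep3 e y b"
    by (rule indep3_exchange[OF exb V.join_left y_in ey])
  have bx: "matched b b' x x'" using matched_triple(1)[OF exb x b] by (rule matched_sym)
  have by': "matched b b' y y'" using matched_triple(1)[OF eyb y b] by (rule matched_sym)
  have "V.indep3 x y b" by (rule indep3_exchange[OF exb V.join_right y_in ind])
  then have "V.indep3 b x y" using V.indep3_rotate by blast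
  then show ?thesis using bx by' by (rule matched_triple(1))
qed

text \<open>The image of a vector \<open>x\<close> is the one matched with a fixed \<open>e'\<close>; since that makes sense only for
  \<open>x\<close> outside \<open>pt e\<close>, a second reference vector \<open>a\<close> is used as well, and the two agree where both
  apply.\<close>

lemma coherent_lift:
  obtains \<Phi> where "\<Phi> 0 = 0" "\<And>x. x \<noteq> 0 \<Longrightarrow> rep x (\<Phi> x)"
    "\<And>x y. V.indep2 x y \<Longrightarrow> matched x (\<Phi> x) y (\<Phi> y)"
proof -
  obtain e where "e \<notin> V.join 0 0" using V.dim_at_least_3D[OF dim] by blast
  then have e0: "e \<noteq> 0" using V.subspace_0[OF V.subspace_join] by blast
  obtain a where "a \<notin> V.join e e" using V.dim_at_least_3D[OF dim] by blast
  then have "a \<notin> V.pt e" using V.pt_subset[OF V.subspace_join V.join_left] by blast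
  with e0 have ea: "V.indep2 e a" by (simp add: V.indep2_iff)
  obtain e' where "rep e e'" using e0 rep_ex by blast
  then obtain a' where ma: "matched e e' a a'" using matched_ex ea by blast
  then have me: "matched a a' e e'" by (rule matched_sym)
  define T where "T x x' \<longleftrightarrow> matched e e' x x' \<or> matched a a' x x'" for x x'
  have mixed: "matched x x' y y'"
    if x: "matched e e' x x'" and y: "matched a a' y y'" and ind: "V.indep2 x y" for x x' y y'
  proof (cases "V.indep2 a x \<or> V.indep2 e y")
    case True
    then show ?thesis
      using matched_trans[OF ma x] matched_trans[OF me y] matched_trans x y ind by blast
  next
    case False
    then have x_in: "x \<in> V.pt a" and y_in: "y \<in> V.pt e"
      using V.indep2_nonzero[OF ea] by (simp_all add: V.indep2_iff)
    obtain b where eab: "V.indep3 e a b" using ea by (rule indep3_ex)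
    then obtain b' where b: "matched e e' b b'"
      using V.indep3_pairs matched_ex \<open>rep e e'\<close> by blast
    have ab: "matched a a' b b'" by (rule matched_triple(1)[OF eab ma b])
    have xy_in: "x \<in> V.join e a" "y \<in> V.join e a"
      using x_in y_in V.pt_subset[OF V.subspace_join] V.join_left V.join_right by blast+
    have xyb: "V.indep3 x y b" by (rule indep3_exchange[OF eab xy_in ind])
    then have bxy: "V.indep3 b x y" using V.indep3_rotate by blast
    then have "V.indep2 b x" "V.indep2 b y" using V.indep3_pairs by blast+
    then have "matched b b' x x'" "matched b b' y y'"
      using matched_trans[OF b x] matched_trans[OF ab y] by blast+
    with bxy show ?thesis by (rule matched_triple(1))
  qed
  have compat: "matched x x' y y'" if "T x x'" "T y y'" "V.indep2 x y" for x x' y y'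
  proof -
    have "V.indep2 y x" using that(3) by (simp add: V.indep2_commute)
    with that show ?thesis
      unfolding T_def using matched_trans mixed matched_sym by (elim disjE) blast+
  qed
  have T_ex: "\<exists>x'. T x x'" if "x \<noteq> 0" for x
  proof -
    have "V.indep2 e x \<or> V.indep2 a x"
      using ea e0 V.indep2_nonzero[OF ea] that by (auto simp: V.indep2_iff_pt_neq)
    then show ?thesis
    proof
      assume "V.indep2 e x"
      then show ?thesis using matched_ex \<open>rep e e'\<close> unfolding T_def by blast
    next
      assume "V.indep2 a x"
      moreover have "rep a a'" using me by (simp add: matched_def)
      ultimately show ?thesis using matched_ex unfolding T_def by blast
    qed
  qed
  define \<Phi> where "\<Phi> x = (if x = 0 then 0 else SOME x'. T x x')" for x
  have T: "T x (\<Phi> x)" if "x \<noteq> 0" for x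
    using someI_ex[OF T_ex[OF that]] that by (simp add: \<Phi>_def)
  show thesis
  proof (rule that)
    show "\<Phi> 0 = 0" by (simp add: \<Phi>_def)
    show "rep x (\<Phi> x)" if "x \<noteq> 0" for x using T[OF that] by (auto simp: T_def matched_def)
    show "matched x (\<Phi> x) y (\<Phi> y)" if "V.indep2 x y" for x y
      using compat T that V.indep2_nonzero by blast
  qed
qed

text \<open>For independent \<open>x\<close> and \<open>y\<close>, both \<open>\<Phi> (x + y)\<close> and \<open>\<Phi> x + \<Phi> y\<close> are matched with \<open>x + y\<close> by a third
  independent vector. For proportional ones, adding a vector \<open>w\<close> outside their line reduces the claim
  to independent pairs.\<close>

lemma additive_lift:
  obtains \<Phi> where "\<And>x y. \<Phi> (x + y) = \<Phi> x + \<Phi> y" "\<And>x. x \<noteq> 0 \<Longrightarrow> rep x (\<Phi> x)"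
proof -
  obtain \<Phi> where \<Phi>: "\<Phi> 0 = 0" "\<And>x. x \<noteq> 0 \<Longrightarrow> rep x (\<Phi> x)"
    "\<And>x y. V.indep2 x y \<Longrightarrow> matched x (\<Phi> x) y (\<Phi> y)" using coherent_lift by blast
  have indep: "\<Phi> (x + y) = \<Phi> x + \<Phi> y" if ind: "V.indep2 x y" for x y
  proof -
    obtain w where "V.indep3 x y w" using ind by (rule indep3_ex)
    then have w: "V.indep3 w x y" using V.indep3_rotate by blast
    then have "matched w (\<Phi> w) (x + y) (\<Phi> x + \<Phi> y)"
      using \<Phi>(3) V.indep3_pairs by (intro matched_triple(2)) blast+
    moreover have "matched w (\<Phi> w) (x + y) (\<Phi> (x + y))"
      using w by (intro \<Phi>(3) V.indep3_add)
    ultimately show ?thesis using matched_unique by blast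
  qed
  have "\<Phi> (x + y) = \<Phi> x + \<Phi> y" for x y
  proof (cases "x = 0 \<or> y = 0 \<or> V.indep2 x y")
    case True
    then show ?thesis using indep \<Phi>(1) by auto
  next
    case False
    then have y: "y \<in> V.pt x" and nz: "x \<noteq> 0" "y \<noteq> 0" by (auto simp: V.indep2_iff)
    then have pty: "V.pt y = V.pt x" by (simp add: V.pt_eq)
    obtain w where "w \<notin> V.join x x" using V.dim_at_least_3D[OF dim] by blast
    then have w: "w \<notin> V.pt x" using V.pt_subset[OF V.subspace_join V.join_left] by blast
    have "w + x \<notin> V.pt y"
      using w pty V.subspace_diff[OF V.subspace_pt, of "w + x" x x] V.pt_self by auto
    then have ind1: "V.indep2 (w + x) y" using nz V.indep2_commute V.indep2_iff by blast
    have ind2: "V.indep2 w x" using w nz V.indep2_commute V.indep2_iff by blast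
    have "\<Phi> (w + (x + y)) = \<Phi> w + \<Phi> (x + y)"
    proof (cases "x + y = 0")
      case False
      have "x + y \<in> V.pt x" using y V.pt_self V.subspace_add[OF V.subspace_pt] by blast
      then have "V.pt (x + y) = V.pt x" using False by (rule V.pt_eq)
      then have "V.indep2 (x + y) w" using False w by (simp add: V.indep2_iff)
      then show ?thesis using indep V.indep2_commute by blast
    qed (simp add: \<Phi>(1))
    moreover have "\<Phi> (w + (x + y)) = \<Phi> w + \<Phi> x + \<Phi> y"
      using indep[OF ind1] indep[OF ind2] by (simp add: add.assoc)
    ultimately show ?thesis by (simp add: add.assoc)
  qed
  with \<Phi>(2) show thesis by (rule that[rotated])
qed

text \<open>This is the fundamental theorem of projective geometry. Instead of an isomorphism of the division
  rings it speaks of scalars \<open>c\<close> and \<open>d\<close> corresponding to each other, which is the part of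
  semilinearity that makes the conjugate of a linear map linear. That \<open>d\<close> does not depend on the vector
  follows by comparing \<open>x\<close>, \<open>y\<close> and \<open>x + y\<close> for independent \<open>x\<close> and \<open>y\<close>.\<close>

theorem semilinear_lift:
  "\<exists>\<Phi>. bij \<Phi> \<and> (\<forall>x y. \<Phi> (x + y) = \<Phi> x + \<Phi> y) \<and>
    (\<forall>x. x \<noteq> 0 \<longrightarrow> f (V.pt x) = W.pt (\<Phi> x)) \<and>
    (\<forall>c. \<exists>d. \<forall>x. \<Phi> (scale d x) = scale' c (\<Phi> x))"
proof -
  obtain \<Phi> where add: "\<And>x y. \<Phi> (x + y) = \<Phi> x + \<Phi> y" and rep: "\<And>x. x \<noteq> 0 \<Longrightarrow> rep x (\<Phi> x)"
    using additive_lift by blast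
  have zero: "\<Phi> 0 = 0" using add[of 0 0] by simp
  have nonzero: "\<Phi> x \<noteq> 0" if "x \<noteq> 0" for x using rep[OF that] by (simp add: rep_def)
  have diff: "\<Phi> (x - y) = \<Phi> x - \<Phi> y" for x y using add[of "x - y" y] by simp
  have inj: "inj \<Phi>"
    by (rule injI) (metis diff nonzero eq_iff_diff_eq_0)
  have pt: "\<Phi> (scale d x) \<in> W.pt (\<Phi> x)" for d x
  proof (cases "scale d x = 0")
    case True
    then show ?thesis using W.subspace_0[OF W.subspace_pt] zero by simp
  next
    case False
    then have "V.pt (scale d x) = V.pt x" using V.pt_eq V.ptI by blast
    moreover have "x \<noteq> 0" using False by auto
    ultimately show ?thesis using rep[OF False] rep[of x] W.pt_self by (metis rep_def)
  qed
  have pointwise: "\<exists>d. \<Phi> (scale d x) = scale' c (\<Phi> x)" if x: "x \<noteq> 0" for c x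
  proof -
    obtain w where "w \<notin> V.join x x" using V.dim_at_least_3D[OF dim] by blast
    then have "w \<notin> V.pt x" using V.pt_subset[OF V.subspace_join V.join_left] by blast
    then have wx: "V.indep2 w x" using x V.indep2_commute V.indep2_iff by blast
    then have w: "w \<noteq> 0" using V.indep2_nonzero by blast
    have wx': "W.indep2 (\<Phi> w) (\<Phi> x)" using rep_indep2[OF rep[OF w] rep[OF x]] wx by simp
    \<comment> \<open>The point spanned by \<open>\<Phi> w + c \<Phi> x\<close> is the image of one spanned by a vector \<open>w + d x\<close>.\<close>
    let ?y = "\<Phi> w + scale' c (\<Phi> x)"
    have y_notin: "?y \<notin> W.pt (\<Phi> x)"
    proof
      assume "?y \<in> W.pt (\<Phi> x)"
      then have "?y - scale' c (\<Phi> x) \<in> W.pt (\<Phi> x)"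
        using W.ptI by (intro W.subspace_diff W.subspace_pt)
      moreover have "W.indep2 (\<Phi> x) (\<Phi> w)" using wx' W.indep2_commute by blast
      ultimately show False by (simp add: W.indep2_iff)
    qed
    then have "?y \<noteq> 0" using W.subspace_0[OF W.subspace_pt] by metis
    then obtain z where z: "rep z ?y" using rep_surj by blast
    have "?y \<in> W.join (\<Phi> w) (\<Phi> x)" using W.joinI[of 1 "\<Phi> w" c "\<Phi> x"] by (simp add: W.scale_one)
    then have "z \<in> V.join w x" using rep_join[OF rep[OF w] rep[OF x] z wx] by simp
    then obtain a b where ab: "z = scale a w + scale b x" by (rule V.joinE)
    have "a \<noteq> 0"
    proof
      assume "a = 0"
      then have "\<not> V.indep2 x z" using ab by (simp add: V.indep2_iff V.ptI)
      then show False
        using rep_indep2[OF rep[OF x] z] y_notin nonzero[OF x] by (simp add: W.indep2_iff)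
    qed
    define d where "d = inverse a * b"
    have "w + scale d x = scale (inverse a) z"
      using ab \<open>a \<noteq> 0\<close> by (simp add: d_def V.scale_simps)
    moreover have "z \<noteq> 0" using z by (simp add: rep_def)
    ultimately have "w + scale d x \<in> V.pt z" "w + scale d x \<noteq> 0"
      using V.ptI \<open>a \<noteq> 0\<close> by (auto simp: V.scale_eq_0_iff)
    then have "rep (w + scale d x) ?y"
      using rep_cong[OF z _ _ W.pt_self] \<open>?y \<noteq> 0\<close> by blast
    then have "\<Phi> (w + scale d x) \<in> W.pt ?y"
      using rep_unique rep \<open>w + scale d x \<noteq> 0\<close> by blast
    then obtain k where k: "\<Phi> w + \<Phi> (scale d x) = scale' k ?y" by (auto simp: add elim: W.ptE)
    obtain m where m: "\<Phi> (scale d x) = scale' m (\<Phi> x)" using pt by (rule W.ptE)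
    have "scale' (1 - k) (\<Phi> w) + scale' (m - k * c) (\<Phi> x) = 0"
      using k m by (simp add: W.scale_simps algebra_simps)
    then have "1 - k = 0" "m - k * c = 0" using wx' unfolding W.indep2_def by blast+
    then have "m = c" by simp
    with m show ?thesis by blast
  qed
  have uniform: "\<exists>d. \<forall>x. \<Phi> (scale d x) = scale' c (\<Phi> x)" for c
  proof -
    have "\<forall>x. \<exists>d. x \<noteq> 0 \<longrightarrow> \<Phi> (scale d x) = scale' c (\<Phi> x)"
      using pointwise by blast
    then have "\<exists>d. \<forall>x. x \<noteq> 0 \<longrightarrow> \<Phi> (scale (d x) x) = scale' c (\<Phi> x)"
      by (rule choice)
    then obtain d where d: "\<And>x. x \<noteq> 0 \<Longrightarrow> \<Phi> (scale (d x) x) = scale' c (\<Phi> x)" by blast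
    have indep: "d x = d y" if ind: "V.indep2 x y" for x y
    proof -
      have nz: "x \<noteq> 0" "y \<noteq> 0" "x + y \<noteq> 0"
        using V.indep2_nonzero[OF ind] V.indep2_nonzero[OF V.indep2_add[OF ind]] by auto
      have "\<Phi> (scale (d (x + y)) (x + y)) = \<Phi> (scale (d x) x + scale (d y) y)"
        using nz by (simp add: d add W.scale_right_distrib)
      then have "scale (d (x + y)) (x + y) = scale (d x) x + scale (d y) y"
        using inj by (simp add: inj_eq)
      then have "scale (d (x + y) - d x) x + scale (d (x + y) - d y) y = 0"
        by (simp add: V.scale_simps algebra_simps)
      then have "d (x + y) - d x = 0" "d (x + y) - d y = 0"
        using ind unfolding V.indep2_def by blast+
      then show ?thesis by simp
    qed
    obtain e where "e \<notin> V.join 0 0" using V.dim_at_least_3D[OF dim] by blast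
    then have e: "e \<noteq> 0" using V.subspace_0[OF V.subspace_join] by blast
    have "d x = d e" if "x \<noteq> 0" for x
    proof -
      obtain w where w: "w \<notin> V.join e x" using V.dim_at_least_3D[OF dim] by blast
      then have "w \<notin> V.pt e" "w \<notin> V.pt x"
        using V.pt_subset[OF V.subspace_join] V.join_left V.join_right by blast+
      then have "V.indep2 e w" "V.indep2 x w" using e that by (auto simp: V.indep2_iff)
      then show ?thesis using indep by metis
    qed
    then have "\<Phi> (scale (d e) x) = scale' c (\<Phi> x)" for x
      using d[of x] by (cases "x = 0") (simp_all add: zero)
    then show ?thesis by blast
  qed
  have "surj \<Phi>"
    unfolding surj_def
  proof
    fix y show "\<exists>x. y = \<Phi> x"
    proof (cases "y = 0")
      case True
      then show ?thesis using zero by metis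
    next
      case False
      then obtain x where x: "rep x y" using rep_surj by blast
      moreover then have "x \<noteq> 0" by (simp add: rep_def)
      ultimately have "y \<in> W.pt (\<Phi> x)" using rep_unique rep by blast
      then obtain c where c: "y = scale' c (\<Phi> x)" by (rule W.ptE)
      obtain d where "\<And>v. \<Phi> (scale d v) = scale' c (\<Phi> v)" using uniform by blast
      then have "y = \<Phi> (scale d x)" using c by simp
      then show ?thesis ..
    qed
  qed
  with inj have "bij \<Phi>" by (simp add: bij_def)
  moreover have "f (V.pt x) = W.pt (\<Phi> x)" if "x \<noteq> 0" for x
    using rep[OF that] by (simp add: rep_def)
  ultimately show ?thesis using add uniform by (intro exI[of _ \<Phi>]) simp
qed

lemma pgl_mapping: "pgl_mapping scale scale' f"
proof -
  obtain \<Phi> where \<Phi>: "bij \<Phi>" "\<forall>x y. \<Phi> (x + y) = \<Phi> x + \<Phi> y"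
    "\<forall>x. x \<noteq> 0 \<longrightarrow> f (V.pt x) = W.pt (\<Phi> x)" "\<forall>c. \<exists>d. \<forall>x. \<Phi> (scale d x) = scale' c (\<Phi> x)"
    using semilinear_lift by (elim exE conjE)
  have inv1: "inv \<Phi> (\<Phi> x) = x" and inv2: "\<Phi> (inv \<Phi> y) = y" for x y
    using \<Phi>(1) by (simp_all add: bij_def surj_f_inv_f)
  have "\<exists>u'\<in>W.GL. \<forall>P\<in>V.proj_points. f (u ` P) = u' ` f P" if u: "u \<in> V.GL" for u
  proof
    let ?u' = "\<Phi> \<circ> u \<circ> inv \<Phi>"
    have lin: "u (x + y) = u x + u y" "u (scale c x) = scale c (u x)" "bij u" for x y c
      using u by (auto simp: V.GL_def)
    have "bij ?u'" using \<Phi>(1) lin(3) by (intro bij_comp bij_imp_bij_inv)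
    moreover have "?u' (y + z) = ?u' y + ?u' z" for y z
    proof -
      have "inv \<Phi> (y + z) = inv \<Phi> y + inv \<Phi> z" by (metis \<Phi>(2) inv1 inv2)
      then show ?thesis by (simp add: \<Phi>(2) lin(1))
    qed
    moreover have "?u' (scale' c y) = scale' c (?u' y)" for c y
    proof -
      obtain d where d: "\<And>x. \<Phi> (scale d x) = scale' c (\<Phi> x)" using \<Phi>(4) by blast
      have "inv \<Phi> (scale' c y) = scale d (inv \<Phi> y)" by (metis d inv1 inv2)
      then show ?thesis by (simp add: lin(2) d)
    qed
    ultimately show u': "?u' \<in> W.GL" by (simp add: W.GL_def)
    show "\<forall>P\<in>V.proj_points. f (u ` P) = ?u' ` f P"
    proof
      fix P assume "P \<in> V.proj_points"
      then obtain x where x: "x \<noteq> 0" "P = V.pt x" by (auto simp: V.proj_points_iff)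
      then have fP: "f P = W.pt (\<Phi> x)" using \<Phi>(3) by simp
      have "f (u ` P) = W.pt (\<Phi> (u x))" using x u by (simp add: V.GL_image_pt V.GL_nonzero \<Phi>(3))
      also have "\<dots> = W.pt (?u' (\<Phi> x))" by (simp add: inv1)
      also have "\<dots> = ?u' ` f P" by (simp only: W.GL_image_pt[OF u'] fP)
      finally show "f (u ` P) = ?u' ` f P" .
    qed
  qed
  moreover have "f \<in> V.proj_points \<rightarrow> W.proj_points" using bij by (auto simp: bij_betw_apply)
  ultimately show ?thesis by (simp add: pgl_mapping_iff)
qed

end

context two_vector_spaces
begin

lemma collineation_imp_pgl_mapping:
  assumes dim: "V.dim_at_least UNIV 3" and col: "collineation scale scale' f"
  shows "pgl_mapping scale scale' f"
proof -
  have bij: "bij_betw f V.proj_points W.proj_points"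
    and fwd: "\<And>P Q T. V.collinear P Q T \<Longrightarrow> W.collinear (f P) (f Q) (f T)"
    and bwd: "\<And>P Q T. W.collinear P Q T \<Longrightarrow> V.collinear (inv_into V.proj_points f P)
      (inv_into V.proj_points f Q) (inv_into V.proj_points f T)"
    using col by (auto simp: collineation_def semicollineation_def)
  have "inv_into V.proj_points f (f P) = P" if "P \<in> V.proj_points" for P
    using that bij by (simp add: bij_betw_inv_into_left)
  then have iff: "W.collinear (f P) (f Q) (f T) \<longleftrightarrow> V.collinear P Q T"
    if "P \<in> V.proj_points" "Q \<in> V.proj_points" "T \<in> V.proj_points" for P Q T
    using that fwd[of P Q T] bwd[of "f P" "f Q" "f T"] by auto
  interpret collinear_bijection scale scale' f
    by unfold_locales (fact bij iff dim)+
  show ?thesis by (rule pgl_mapping)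
qed

lemma collineation_inverse:
  assumes bij: "bij_betw f V.proj_points W.proj_points" and col: "collineation scale scale' f"
  shows "collineation scale' scale (inv_into V.proj_points f)"
proof -
  let ?g = "inv_into V.proj_points f"
  have g: "bij_betw ?g W.proj_points V.proj_points" using bij by (rule bij_betw_inv_into)
  have eq: "inv_into W.proj_points ?g P = f P" if "P \<in> V.proj_points" for P
    using bij that by (rule inv_into_inv_into_eq)
  have "semicollineation scale scale' (inv_into W.proj_points ?g)"
    unfolding semicollineation_def
  proof (intro conjI allI impI)
    show "bij_betw (inv_into W.proj_points ?g) V.proj_points W.proj_points"
      using g by (rule bij_betw_inv_into)
  next
    fix P Q T assume PQT: "V.collinear P Q T"
    then have "P \<in> V.proj_points" "Q \<in> V.proj_points" "T \<in> V.proj_points"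
      by (auto simp: V.collinear_def V.proj_lines_def)
    moreover have "W.collinear (f P) (f Q) (f T)"
      using col PQT by (simp add: collineation_def semicollineation_def)
    ultimately show "W.collinear (inv_into W.proj_points ?g P) (inv_into W.proj_points ?g Q)
        (inv_into W.proj_points ?g T)" by (simp add: eq)
  qed
  with col show ?thesis by (simp add: collineation_def)
qed

end

theorem corollary1:
  fixes scale :: "'r::division_ring \<Rightarrow> 'v::ab_group_add \<Rightarrow> 'v"
    and scale' :: "'s::division_ring \<Rightarrow> 'w::ab_group_add \<Rightarrow> 'w"
    and f :: "'v set \<Rightarrow> 'w set"
  assumes "left_vector_space scale"
    and "left_vector_space scale'"
    and "left_vector_space.dim_at_least scale UNIV 3"
    and "left_vector_space.dim_at_least scale' UNIV 3"
    and "bij_betw f (left_vector_space.proj_points scale) (left_vector_space.proj_points scale')"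
  shows "collineation scale scale' f \<longleftrightarrow>
    pgl_mapping scale scale' f \<and>
    pgl_mapping scale' scale (inv_into (left_vector_space.proj_points scale) f)"
proof -
  interpret VW: two_vector_spaces scale scale'
    using assms(1,2) by (simp add: two_vector_spaces_def)
  interpret WV: two_vector_spaces scale' scale
    using assms(1,2) by (simp add: two_vector_spaces_def)
  note bij = assms(5)
  let ?g = "inv_into VW.V.proj_points f"
  have g: "bij_betw ?g VW.W.proj_points VW.V.proj_points" using bij by (rule bij_betw_inv_into)
  have gf: "?g (f P) = P" if "P \<in> VW.V.proj_points" for P
    using that bij by (simp add: bij_betw_inv_into_left)
  have fg: "f (?g Q) = Q" if "Q \<in> VW.W.proj_points" for Q
    using that bij by (simp add: bij_betw_inv_into_right)
  have f_mem: "f P \<in> VW.W.proj_points" if "P \<in> VW.V.proj_points" for P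
    using that bij by (auto simp: bij_betw_apply)
  have g_mem: "?g Q \<in> VW.V.proj_points" if "Q \<in> VW.W.proj_points" for Q
    using that g by (auto simp: bij_betw_apply)
  show ?thesis
  proof
    assume "collineation scale scale' f"
    then show "pgl_mapping scale scale' f \<and> pgl_mapping scale' scale ?g"
      using VW.collineation_imp_pgl_mapping WV.collineation_imp_pgl_mapping
        VW.collineation_inverse assms by blast
  next
    assume pgl: "pgl_mapping scale scale' f \<and> pgl_mapping scale' scale ?g"
    have conj: "\<exists>u'\<in>VW.W.GL. \<forall>P\<in>VW.V.proj_points. f (u ` P) = u' ` f P" if "u \<in> VW.V.GL" for u
      using pgl that by (simp add: VW.pgl_mapping_iff)
    have conj': "\<exists>u\<in>VW.V.GL. \<forall>Q\<in>VW.W.proj_points. ?g (u' ` Q) = u ` ?g Q" if "u' \<in> VW.W.GL" for u'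
      using pgl that by (simp add: WV.pgl_mapping_iff)
    \<comment> \<open>As \<open>f\<close> is bijective, \<open>u'\<close> induces the conjugate of \<open>u\<close> under \<open>f\<close> if and only if \<open>u\<close> induces
      the conjugate of \<open>u'\<close> under the inverse of \<open>f\<close>.\<close>
    have flip: "\<exists>u\<in>VW.V.GL. \<forall>P\<in>VW.V.proj_points. f (u ` P) = u' ` f P" if "u' \<in> VW.W.GL" for u'
      using conj'[OF that] VW.W.GL_image_point[OF that] by (metis f_mem fg gf)
    have flip': "\<exists>u'\<in>VW.W.GL. \<forall>Q\<in>VW.W.proj_points. ?g (u' ` Q) = u ` ?g Q" if "u \<in> VW.V.GL" for u
      using conj[OF that] VW.V.GL_image_point[OF that] by (metis g_mem fg gf)
    have "semicollineation scale scale' f"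
      using assms(3,4) bij conj flip by (rule VW.pgl_mappings_imp_semicollineation)
    moreover have "semicollineation scale' scale ?g"
      using assms(4,3) g conj' flip' by (rule WV.pgl_mappings_imp_semicollineation)
    ultimately show "collineation scale scale' f" by (simp add: collineation_def)
  qed
qed

end
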